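(* For every $n\ge 1$, the power sum symmetric function $p_n=\sum_i X_i^n$ (a primitive element) satisfies $$p_n=\frac{n}{1-t^{n}}\sum_{\lambda\vdash n}(-1)^{l(\lambda)+1}\frac{1}{l(\lambda)}\binom{l(\lambda)}{m_1(\lambda),\dots,m_n(\lambda)}c_{\lambda}(X;t),$$ where the sum is over all partitions $\lambda=(1^{m_1(\lambda)},\dots,n^{m_n(\lambda)})$ of $n$, $m_i(\lambda)$ is the multiplicity of $i$ in $\lambda$, $l(\lambda)$ is the length of $\lambda$, and $c_\lambda(X;t)=c_1(X;t)^{m_1(\lambda)}\cdots c_n(X;t)^{m_n(\lambda)}$.
   Context: $\Lambda$ is the ring of symmetric functions over $\mathbb{Q}$ in variables $X=(X_1,X_2,\dots)$, $\Lambda[t]=\Lambda\otimes_{\mathbb{Q}}\mathbb{Q}[t]$, and $p_n=p_n(X)=\sum_i X_i^n$. The Hopf algebra structure on $\Lambda=\mathbb{Q}[p_1,p_2,\dots]$ is given by $\Delta(p_n)=p_n\otimes1+1\otimes p_n$, $\epsilon(p_n)=0$, $S(p_n)=-p_n$, so the $p_n$ are primitive. The cyclic symmetric functions $c_n(X;t)\in\Lambda[t]$ are defined by $$1+\sum_{n\ge1}c_n(X;t)T^n=\frac{H(T)}{H(tT)}=\exp\Big(\sum_{n\ge1}\frac{1-t^n}{n}p_nT^n\Big),\qquad H(T)=\prod_{i\ge1}(1-X_iT)^{-1}.$$ The identity is understood in $\Lambda\otimes_{\mathbb{Q}}\mathbb{Q}(t)$. *)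

theory Defs
  imports
    "HOL-Library.Multiset"
    "HOL-Computational_Algebra.Computational_Algebra"
begin

section \<open>Formal power series in the variables \<open>X\<^sub>0, X\<^sub>1, \<dots>\<close>\<close>

text \<open>
  A monomial is a finite multiset of variable indices: \<open>m\<close> stands for the product of the
  \<open>X\<^sub>i\<close> over \<open>i \<in># m\<close>, so that multiplying monomials is adding multisets and the degree
  is the size. Indices start at 0 instead of 1.
\<close>

typedef 'a mseries = "UNIV :: (nat multiset \<Rightarrow> 'a) set"
  morphisms mcoeff Abs_mseries ..

setup_lifting type_definition_mseries

lemma mcoeff_Abs [simp]: "mcoeff (Abs_mseries f) = f"
  by (simp add: Abs_mseries_inverse)

lemma mseries_eqI: "(\<And>m. mcoeff f m = mcoeff g m) \<Longrightarrow> f = g"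
  by (metis ext mcoeff_inject)

definition msplits :: "nat multiset \<Rightarrow> (nat multiset \<times> nat multiset) set" where
  "msplits m = {(k, l). k + l = m}"

lemma finite_msubsets: "finite {k. k \<subseteq># (m :: nat multiset)}"
proof (rule finite_subset)
  show "{k. k \<subseteq># m} \<subseteq> (\<Union>n\<le>size m. multisets_of_size (set_mset m) n)"
    by (auto simp: multisets_of_size_def size_mset_mono dest: mset_subset_eqD)
  show "finite (\<Union>n\<le>size m. multisets_of_size (set_mset m) n)"
    by (intro finite_UN_I finite_multisets_of_size finite_atMost finite_set_mset)
qed

lemma finite_msplits [simp, intro]: "finite (msplits m)"
proof (rule finite_subset)
  show "msplits m \<subseteq> {k. k \<subseteq># m} \<times> {k. k \<subseteq># m}"
    by (auto simp: msplits_def)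
qed (simp add: finite_msubsets)

lemma msplits_empty [simp]: "msplits {#} = {({#}, {#})}"
  by (auto simp: msplits_def)

instantiation mseries :: (comm_ring_1) comm_ring_1
begin

lift_definition zero_mseries :: "'a mseries" is "\<lambda>_. 0" .
lift_definition one_mseries :: "'a mseries" is "\<lambda>m. if m = {#} then 1 else 0" .
lift_definition plus_mseries :: "'a mseries \<Rightarrow> 'a mseries \<Rightarrow> 'a mseries" is "\<lambda>f g m. f m + g m" .
lift_definition minus_mseries :: "'a mseries \<Rightarrow> 'a mseries \<Rightarrow> 'a mseries" is "\<lambda>f g m. f m - g m" .
lift_definition uminus_mseries :: "'a mseries \<Rightarrow> 'a mseries" is "\<lambda>f m. - f m" .
lift_definition times_mseries :: "'a mseries \<Rightarrow> 'a mseries \<Rightarrow> 'a mseries" is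
  "\<lambda>f g m. \<Sum>(k, l)\<in>msplits m. f k * g l" .

instance
proof
  fix f g h :: "'a mseries"
  show "f * g * h = f * (g * h)"
  proof (transfer, rule ext)
    fix f g h :: "nat multiset \<Rightarrow> 'a" and m
    have "(\<Sum>(k, l)\<in>msplits m. (\<Sum>(a, b)\<in>msplits k. f a * g b) * h l) =
          (\<Sum>((k, l), (a, b))\<in>Sigma (msplits m) (\<lambda>x. msplits (fst x)). f a * g b * h l)"
      by (simp add: sum_distrib_right sum.Sigma split_beta)
    also have "\<dots> = (\<Sum>((k, l), (a, b))\<in>Sigma (msplits m) (\<lambda>x. msplits (snd x)). f k * g a * h b)"
      by (rule sum.reindex_bij_witness
            [where i = "\<lambda>((k, l), (a, b)). ((k + a, b), (k, a))"
               and j = "\<lambda>((k, l), (a, b)). ((a, b + l), (b, l))"])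
         (auto simp: msplits_def add.assoc)
    also have "\<dots> = (\<Sum>(k, l)\<in>msplits m. f k * (\<Sum>(a, b)\<in>msplits l. g a * h b))"
      by (simp add: sum_distrib_left sum.Sigma split_beta mult.assoc)
    finally show "(\<Sum>(k, l)\<in>msplits m. (\<Sum>(a, b)\<in>msplits k. f a * g b) * h l) =
                  (\<Sum>(k, l)\<in>msplits m. f k * (\<Sum>(a, b)\<in>msplits l. g a * h b))" .
  qed
  show "f * g = g * f"
  proof (transfer, rule ext)
    fix f g :: "nat multiset \<Rightarrow> 'a" and m
    show "(\<Sum>(k, l)\<in>msplits m. f k * g l) = (\<Sum>(k, l)\<in>msplits m. g k * f l)"
      by (rule sum.reindex_bij_witness[where i = prod.swap and j = prod.swap])
         (auto simp: msplits_def add.commute mult.commute)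
  qed
  show "1 * f = f"
  proof (transfer, rule ext)
    fix f :: "nat multiset \<Rightarrow> 'a" and m
    have "(\<Sum>(k, l)\<in>msplits m. (if k = {#} then 1 else 0) * f l) = (\<Sum>(k :: nat multiset, l)\<in>{({#}, m)}. f l)"
      by (rule sum.mono_neutral_cong_right[OF finite_msplits])
         (auto simp: msplits_def split: if_splits)
    then show "(\<Sum>(k, l)\<in>msplits m. (if k = {#} then 1 else 0) * f l) = f m"
      by simp
  qed
  show "(f + g) * h = f * h + g * h"
    by (transfer, rule ext) (simp add: split_beta distrib_right sum.distrib)
  show "(0 :: 'a mseries) \<noteq> 1"
    by transfer (metis zero_neq_one)
qed (transfer, simp add: fun_eq_iff add_ac)+

end

lemma mcoeff_ring_simps [simp]:
  fixes f g :: "'a :: comm_ring_1 mseries"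
  shows "mcoeff (0 :: 'a mseries) m = 0"
    and "mcoeff (f + g) m = mcoeff f m + mcoeff g m"
    and "mcoeff (f - g) m = mcoeff f m - mcoeff g m"
    and "mcoeff (- f) m = - mcoeff f m"
  by (transfer, simp)+

lemma mcoeff_1: "mcoeff (1 :: 'a :: comm_ring_1 mseries) m = (if m = {#} then 1 else 0)"
  by transfer simp

lemma mcoeff_mult:
  "mcoeff (f * g :: 'a :: comm_ring_1 mseries) m = (\<Sum>(k, l)\<in>msplits m. mcoeff f k * mcoeff g l)"
  by transfer simp

lemma mcoeff_sum: "mcoeff (sum f A :: 'a :: comm_ring_1 mseries) m = (\<Sum>x\<in>A. mcoeff (f x) m)"
  by (induction A rule: infinite_finite_induct) auto

definition mvar :: "nat \<Rightarrow> 'a :: comm_ring_1 mseries" where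
  "mvar i = Abs_mseries (\<lambda>m. if m = {#i#} then 1 else 0)"

text \<open>
  Limit of a sequence in which every single coefficient is eventually constant (unspecified
  for other sequences); it gives a meaning to sums and products over all variables.
\<close>

definition mlim :: "(nat \<Rightarrow> 'a mseries) \<Rightarrow> 'a mseries" where
  "mlim F = Abs_mseries (\<lambda>m. THE a. \<forall>\<^sub>F N in sequentially. mcoeff (F N) m = a)"

lemma mlim_eqI:
  assumes "\<And>m. \<forall>\<^sub>F N in sequentially. mcoeff (F N) m = mcoeff f m"
  shows "mlim F = f"
proof (rule mseries_eqI)
  fix m
  have "(THE a. \<forall>\<^sub>F N in sequentially. mcoeff (F N) m = a) = mcoeff f m"
  proof (rule the_equality)
    fix a assume "\<forall>\<^sub>F N in sequentially. mcoeff (F N) m = a"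
    with assms[of m] have "\<forall>\<^sub>F N in sequentially. a = mcoeff f m"
      by eventually_elim simp
    then show "a = mcoeff f m" by simp
  qed (rule assms)
  then show "mcoeff (mlim F) m = mcoeff f m" by (simp add: mlim_def)
qed


section \<open>Symmetric functions\<close>

text \<open>
  The ring of symmetric functions with coefficients in a commutative ring \<open>R\<close>: series of
  bounded degree that are invariant under permutations of the variables. As the degree is bounded
  and the monomial symmetric functions form a basis, this is \<open>\<Lambda> \<otimes> R\<close>. In particular
  \<open>\<Lambda>\<close> is \<^typ>\<open>rat\<close> \<open>symfun\<close>, \<open>\<Lambda>[t]\<close> is \<^typ>\<open>rat poly\<close> \<open>symfun\<close>,
  \<open>\<Lambda> \<otimes> \<rat>(t)\<close> is \<^typ>\<open>rat poly fract\<close> \<open>symfun\<close>, and \<open>\<Lambda> \<otimes> \<Lambda>\<close> is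
  \<open>rat symfun symfun\<close>.
\<close>

typedef (overloaded) 'a symfun =
  "{f :: 'a :: comm_ring_1 mseries.
     (\<forall>\<sigma> m. bij \<sigma> \<longrightarrow> mcoeff f (image_mset \<sigma> m) = mcoeff f m) \<and>
     (\<exists>d. \<forall>m. size m > d \<longrightarrow> mcoeff f m = 0)}"
  morphisms series_of Abs_symfun
  by (rule exI[of _ 0]) auto

setup_lifting type_definition_symfun

lemma msplits_image:
  assumes "bij \<sigma>"
  shows "msplits (image_mset \<sigma> m) = (\<lambda>(k, l). (image_mset \<sigma> k, image_mset \<sigma> l)) ` msplits m"
proof (rule set_eqI, safe)
  fix k l assume "(k, l) \<in> msplits (image_mset \<sigma> m)"
  then have "k + l = image_mset \<sigma> m" by (simp add: msplits_def)
  then have "image_mset (inv \<sigma>) k + image_mset (inv \<sigma>) l = m"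
    using assms by (metis image_mset_union multiset.map_comp multiset.map_id inv_o_cancel bij_is_inj)
  moreover have "image_mset \<sigma> (image_mset (inv \<sigma>) a) = a" for a
    using assms by (simp add: multiset.map_comp bij_is_surj surj_iff[THEN iffD1])
  ultimately show "(k, l) \<in> (\<lambda>(k, l). (image_mset \<sigma> k, image_mset \<sigma> l)) ` msplits m"
    by (intro image_eqI[of _ _ "(image_mset (inv \<sigma>) k, image_mset (inv \<sigma>) l)"])
       (auto simp: msplits_def)
qed (auto simp: msplits_def)

lemma inj_image_mset: "inj \<sigma> \<Longrightarrow> inj (image_mset \<sigma>)"
  by (rule inj_on_inverseI[of _ "image_mset (inv \<sigma>)"]) (simp add: multiset.map_comp)

instantiation symfun :: (comm_ring_1) comm_ring_1
begin

lift_definition zero_symfun :: "'a symfun" is 0 by auto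
lift_definition one_symfun :: "'a symfun" is 1 by (auto simp: mcoeff_1)

lift_definition plus_symfun :: "'a symfun \<Rightarrow> 'a symfun \<Rightarrow> 'a symfun" is "(+)"
proof (elim conjE exE, intro CollectI conjI)
  fix f g :: "'a mseries" and d d'
  assume "\<forall>m. size m > d \<longrightarrow> mcoeff f m = 0" "\<forall>m. size m > d' \<longrightarrow> mcoeff g m = 0"
  then show "\<exists>d. \<forall>m. size m > d \<longrightarrow> mcoeff (f + g) m = 0"
    by (intro exI[of _ "max d d'"]) auto
qed auto

lift_definition uminus_symfun :: "'a symfun \<Rightarrow> 'a symfun" is uminus by auto

lift_definition minus_symfun :: "'a symfun \<Rightarrow> 'a symfun \<Rightarrow> 'a symfun" is "(-)"
proof (elim conjE exE, intro CollectI conjI)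
  fix f g :: "'a mseries" and d d'
  assume "\<forall>m. size m > d \<longrightarrow> mcoeff f m = 0" "\<forall>m. size m > d' \<longrightarrow> mcoeff g m = 0"
  then show "\<exists>d. \<forall>m. size m > d \<longrightarrow> mcoeff (f - g) m = 0"
    by (intro exI[of _ "max d d'"]) auto
qed auto

lift_definition times_symfun :: "'a symfun \<Rightarrow> 'a symfun \<Rightarrow> 'a symfun" is "(*)"
proof (elim conjE exE, intro CollectI conjI allI impI)
  fix f g :: "'a mseries" and \<sigma> :: "nat \<Rightarrow> nat" and m
  assume sym: "\<forall>\<sigma> m. bij \<sigma> \<longrightarrow> mcoeff f (image_mset \<sigma> m) = mcoeff f m"
    "\<forall>\<sigma> m. bij \<sigma> \<longrightarrow> mcoeff g (image_mset \<sigma> m) = mcoeff g m" and \<sigma>: "bij \<sigma>"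
  from \<sigma> have "inj (image_mset \<sigma>)" by (intro inj_image_mset bij_is_inj)
  then have inj: "inj_on (\<lambda>(k, l). (image_mset \<sigma> k, image_mset \<sigma> l)) (msplits m)"
    by (auto simp: inj_on_def dest: injD)
  show "mcoeff (f * g) (image_mset \<sigma> m) = mcoeff (f * g) m"
    unfolding mcoeff_mult msplits_image[OF \<sigma>]
    by (subst sum.reindex[OF inj]) (use sym \<sigma> in \<open>auto intro!: sum.cong\<close>)
next
  fix f g :: "'a mseries" and d d'
  assume *: "\<forall>m. size m > d \<longrightarrow> mcoeff f m = 0" "\<forall>m. size m > d' \<longrightarrow> mcoeff g m = 0"
  show "\<exists>d. \<forall>m. size m > d \<longrightarrow> mcoeff (f * g) m = 0"
  proof (intro exI[of _ "d + d'"] allI impI)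
    fix m :: "nat multiset" assume m: "size m > d + d'"
    show "mcoeff (f * g) m = 0" unfolding mcoeff_mult
    proof (intro sum.neutral ballI, clarify)
      fix k l assume "(k, l) \<in> msplits m"
      with m have "size k > d \<or> size l > d'" by (auto simp: msplits_def)
      then show "mcoeff f k * mcoeff g l = 0" using * by auto
    qed
  qed
qed

instance
  by standard (transfer, simp add: algebra_simps)+

end

definition sf_coeff :: "'a :: comm_ring_1 symfun \<Rightarrow> nat multiset \<Rightarrow> 'a" where
  "sf_coeff f = mcoeff (series_of f)"

lemma symfun_eqI: "(\<And>m. sf_coeff f m = sf_coeff g m) \<Longrightarrow> f = g"
  unfolding sf_coeff_def by (metis mseries_eqI series_of_inject)

lemma sf_coeff_sym: "bij \<sigma> \<Longrightarrow> sf_coeff f (image_mset \<sigma> m) = sf_coeff f m"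
  unfolding sf_coeff_def by transfer auto

lemma sf_coeff_bounded: "\<exists>d. \<forall>m. size m > d \<longrightarrow> sf_coeff f m = 0"
  unfolding sf_coeff_def by transfer auto

lemma sf_coeff_simps [simp]:
  "sf_coeff 0 m = 0"
  "sf_coeff (f + g) m = sf_coeff f m + sf_coeff g m"
  "sf_coeff (f - g) m = sf_coeff f m - sf_coeff g m"
  "sf_coeff (- f) m = - sf_coeff f m"
  unfolding sf_coeff_def by (transfer, simp)+

lemma sf_coeff_1: "sf_coeff 1 m = (if m = {#} then 1 else 0)"
  unfolding sf_coeff_def by transfer (simp add: mcoeff_1)

lemma sf_coeff_mult: "sf_coeff (f * g) m = (\<Sum>(k, l)\<in>msplits m. sf_coeff f k * sf_coeff g l)"
  unfolding sf_coeff_def by transfer (simp add: mcoeff_mult)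

lemma sf_coeff_sum: "sf_coeff (sum f A) m = (\<Sum>x\<in>A. sf_coeff (f x) m)"
  by (induction A rule: infinite_finite_induct) auto

lift_definition sf_const :: "'a :: comm_ring_1 \<Rightarrow> 'a symfun" is
  "\<lambda>c. Abs_mseries (\<lambda>m. if m = {#} then c else 0)"
  by auto

lemma sf_coeff_const: "sf_coeff (sf_const c) m = (if m = {#} then c else 0)"
  unfolding sf_coeff_def by transfer simp

lemma sf_const_0 [simp]: "sf_const 0 = 0"
  by (rule symfun_eqI) (simp add: sf_coeff_const)

lemma sf_const_1 [simp]: "sf_const 1 = 1"
  by (rule symfun_eqI) (simp add: sf_coeff_const sf_coeff_1)

lemma sf_coeff_const_mult: "sf_coeff (sf_const c * f) m = c * sf_coeff f m"
proof -
  have "(\<Sum>(k, l)\<in>msplits m. sf_coeff (sf_const c) k * sf_coeff f l)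
        = (\<Sum>(k :: nat multiset, l)\<in>{({#}, m)}. c * sf_coeff f l)"
    by (rule sum.mono_neutral_cong_right[OF finite_msplits])
       (auto simp: msplits_def sf_coeff_const split: if_splits)
  then show ?thesis by (simp add: sf_coeff_mult)
qed

text \<open>
  Extension of scalars along a ring homomorphism \<open>\<phi>\<close>, acting on coefficients. The test for
  0 is redundant whenever \<open>\<phi> 0 = 0\<close>, and only makes the operation total.
\<close>

lift_definition sf_map :: "('a \<Rightarrow> 'b) \<Rightarrow> 'a :: comm_ring_1 symfun \<Rightarrow> 'b :: comm_ring_1 symfun" is
  "\<lambda>\<phi> f. Abs_mseries (\<lambda>m. if mcoeff f m = 0 then 0 else \<phi> (mcoeff f m))"
  by auto

lemma sf_coeff_map: "\<phi> 0 = 0 \<Longrightarrow> sf_coeff (sf_map \<phi> f) m = \<phi> (sf_coeff f m)"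
  unfolding sf_coeff_def by transfer auto

subsection \<open>Power sums\<close>

text \<open>For \<open>n = 0\<close> the sum diverges, and the value is unspecified.\<close>

definition psum :: "nat \<Rightarrow> 'a :: comm_ring_1 symfun" where
  "psum n = Abs_symfun (mlim (\<lambda>N. \<Sum>i<N. mvar i ^ n))"

lemma mcoeff_mult_mvar:
  "mcoeff (f * mvar i :: 'a :: comm_ring_1 mseries) m = (if i \<in># m then mcoeff f (m - {#i#}) else 0)"
proof (cases "i \<in># m")
  case True
  have "(\<Sum>(k, l)\<in>msplits m. mcoeff f k * mcoeff (mvar i) l) =
        (\<Sum>(k, l)\<in>{(m - {#i#}, {#i#})}. mcoeff f k)"
    by (rule sum.mono_neutral_cong_right[OF finite_msplits])
       (use True in \<open>auto simp: msplits_def mvar_def split: if_splits\<close>)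
  with True show ?thesis by (simp add: mcoeff_mult)
next
  case False
  have "(\<Sum>(k, l)\<in>msplits m. mcoeff f k * mcoeff (mvar i) l) = 0"
    using False by (intro sum.neutral) (auto simp: msplits_def mvar_def)
  with False show ?thesis by (simp add: mcoeff_mult)
qed

lemma mcoeff_mvar_power:
  "mcoeff (mvar i ^ n :: 'a :: comm_ring_1 mseries) m = (if m = replicate_mset n i then 1 else 0)"
proof (induction n arbitrary: m)
  case (Suc n)
  have "i \<in># m \<and> m - {#i#} = replicate_mset n i \<longleftrightarrow> m = replicate_mset (Suc n) i"
    by (metis add_mset_remove_trivial insert_DiffM multi_member_this replicate_mset_Suc union_single_eq_member)
  then show ?case
    by (simp only: power_Suc2 mcoeff_mult_mvar Suc) auto
qed (simp add: mcoeff_1)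

lemma bij_image_replicate_iff:
  assumes "bij \<sigma>"
  shows "(\<exists>i. image_mset \<sigma> m = replicate_mset n i) \<longleftrightarrow> (\<exists>i. m = replicate_mset n i)"
proof
  assume "\<exists>i. image_mset \<sigma> m = replicate_mset n i"
  then obtain i where "image_mset \<sigma> m = image_mset \<sigma> (replicate_mset n (inv \<sigma> i))"
    using assms by (auto simp: bij_is_surj surj_f_inv_f)
  then show "\<exists>i. m = replicate_mset n i"
    using inj_image_mset[OF bij_is_inj[OF assms]] by (metis injD)
qed auto

lemma sf_coeff_psum:
  assumes "n \<ge> 1"
  shows "sf_coeff (psum n :: 'a :: comm_ring_1 symfun) m =
           (if \<exists>i. m = replicate_mset n i then 1 else 0)"
proof -
  let ?p = "Abs_mseries (\<lambda>m. if \<exists>i. m = replicate_mset n i then 1 else (0 :: 'a))"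
  have "mlim (\<lambda>N. \<Sum>i<N. mvar i ^ n) = ?p"
  proof (rule mlim_eqI)
    fix m
    have fin: "mcoeff (\<Sum>i<N. mvar i ^ n) m = mcoeff ?p m" if N: "N > Max (insert 0 (set_mset m))" for N
    proof (cases "\<exists>i. m = replicate_mset n i")
      case True
      then obtain i where i: "m = replicate_mset n i" by blast
      with N assms have "i < N" by simp
      have "replicate_mset n i = replicate_mset n j \<longleftrightarrow> j = i" for j
        using assms by (metis in_replicate_mset less_eq_Suc_le One_nat_def)
      with \<open>i < N\<close> i show ?thesis
        by (simp add: mcoeff_sum mcoeff_mvar_power)
    next
      case False
      then show ?thesis by (simp add: mcoeff_sum mcoeff_mvar_power)
    qed
    show "\<forall>\<^sub>F N in sequentially. mcoeff (\<Sum>i<N. mvar i ^ n) m = mcoeff ?p m"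
      using eventually_gt_at_top[of "Max (insert 0 (set_mset m))"]
      by eventually_elim (rule fin)
  qed
  moreover have "series_of (Abs_symfun ?p) = ?p"
    by (rule Abs_symfun_inverse) (auto simp: bij_image_replicate_iff)
  ultimately show ?thesis by (simp add: sf_coeff_def psum_def)
qed

lemma sf_map_psum:
  assumes "n \<ge> 1" "\<phi> 0 = 0" "\<phi> 1 = 1"
  shows "sf_map \<phi> (psum n) = psum n"
  using assms by (intro symfun_eqI) (simp add: sf_coeff_map sf_coeff_psum)

subsection \<open>The generating series \<open>H(T)\<close>\<close>

text \<open>
  \<open>1 / (1 - X\<^sub>i T)\<close> is written with \<open>fps_right_inverse\<close> because the coefficients lie in a ring
  without division; the argument 1 is the inverse of the constant coefficient. The product over all
  \<open>i\<close> is taken in the ring of power series in \<open>T\<close> over \<^typ>\<open>'a mseries\<close>, where it converges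
  coefficientwise.
\<close>

definition H_partial :: "nat \<Rightarrow> 'a :: comm_ring_1 mseries fps" where
  "H_partial N = (\<Prod>i<N. fps_right_inverse (1 - fps_const (mvar i) * fps_X) 1)"

definition H_series :: "'a :: comm_ring_1 symfun fps" where
  "H_series = Abs_fps (\<lambda>n. Abs_symfun (mlim (\<lambda>N. H_partial N $ n)))"

lemma mcoeff_H_partial:
  "mcoeff (H_partial N $ n :: 'a :: comm_ring_1 mseries) m =
     (if size m = n \<and> set_mset m \<subseteq> {..<N} then 1 else 0)"
proof -
  define E :: "nat \<Rightarrow> 'a mseries fps" where
    "E = (\<lambda>N. Abs_fps (\<lambda>n. Abs_mseries
            (\<lambda>m. if size m = n \<and> set_mset m \<subseteq> {..<N} then 1 else 0)))"
  have step: "E (Suc N) * (1 - fps_const (mvar N) * fps_X) = E N" for N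
  proof (rule fps_ext, rule mseries_eqI)
    fix n m
    have "(E (Suc N) * (1 - fps_const (mvar N) * fps_X)) $ n =
          E (Suc N) $ n - (if n = 0 then 0 else E (Suc N) $ (n - 1) * mvar N)"
      by (simp add: right_diff_distrib mult.assoc[symmetric] fps_mult_fps_X_commute)
    then have 1: "mcoeff ((E (Suc N) * (1 - fps_const (mvar N) * fps_X)) $ n) m =
          mcoeff (E (Suc N) $ n) m -
          (if n > 0 \<and> N \<in># m then mcoeff (E (Suc N) $ (n - 1)) (m - {#N#}) else 0)"
      by (simp add: mcoeff_mult_mvar)
    show "mcoeff ((E (Suc N) * (1 - fps_const (mvar N) * fps_X)) $ n) m = mcoeff (E N $ n) m"
    proof (cases "N \<in># m")
      case True
      then obtain m' where m': "m = add_mset N m'" by (metis insert_DiffM)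
      show ?thesis unfolding 1 by (auto simp: m' E_def)
    next
      case False
      then have "set_mset m \<subseteq> {..<Suc N} \<longleftrightarrow> set_mset m \<subseteq> {..<N}"
        by (auto simp: less_Suc_eq)
      with False show ?thesis unfolding 1 by (simp add: E_def)
    qed
  qed
  have "H_partial N = E N"
  proof (induction N)
    case 0
    show ?case by (rule fps_ext, rule mseries_eqI) (auto simp: H_partial_def E_def mcoeff_1)
  next
    case (Suc N)
    let ?g = "1 - fps_const (mvar N :: 'a mseries) * fps_X"
    have inv: "?g * fps_right_inverse ?g 1 = 1"
      by (rule fps_right_inverse) simp
    have "H_partial (Suc N) = E N * fps_right_inverse ?g 1"
      using Suc by (simp add: H_partial_def)
    also have "\<dots> = E (Suc N) * (?g * fps_right_inverse ?g 1)"
      by (simp only: step[of N, symmetric] mult.assoc)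
    finally show ?case by (simp only: inv mult_1_right)
  qed
  then show ?thesis by (simp add: E_def)
qed

lemma sf_coeff_H_series:
  "sf_coeff (H_series $ n :: 'a :: comm_ring_1 symfun) m = (if size m = n then 1 else 0)"
proof -
  let ?h = "Abs_mseries (\<lambda>m. if size m = n then 1 else (0 :: 'a))"
  have "mlim (\<lambda>N. H_partial N $ n) = ?h"
  proof (rule mlim_eqI)
    fix m :: "nat multiset"
    show "\<forall>\<^sub>F N in sequentially. mcoeff (H_partial N $ n) m = mcoeff ?h m"
      using eventually_gt_at_top[of "Max (insert 0 (set_mset m))"]
      by eventually_elim (auto simp: mcoeff_H_partial)
  qed
  moreover have "series_of (Abs_symfun ?h) = ?h"
    by (rule Abs_symfun_inverse) auto
  ultimately show ?thesis by (simp add: sf_coeff_def H_series_def)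
qed

lemma H_series_0 [simp]: "H_series $ 0 = (1 :: 'a :: comm_ring_1 symfun)"
  by (rule symfun_eqI) (simp add: sf_coeff_H_series sf_coeff_1)

subsection \<open>Cyclic symmetric functions\<close>

definition H_series_scaled :: "rat poly symfun fps" where
  "H_series_scaled = H_series oo (fps_const (sf_const [:0, 1:]) * fps_X)"

text \<open>
  \<open>H(T) / H(tT)\<close>; the constant coefficient of \<open>H(tT)\<close> is 1.
\<close>

definition cyclic_series :: "rat poly symfun fps" where
  "cyclic_series = H_series * fps_right_inverse H_series_scaled 1"

definition cyclic_sf :: "nat \<Rightarrow> rat poly symfun" where
  "cyclic_sf n = cyclic_series $ n"

lemma cyclic_series_mult: "cyclic_series * H_series_scaled = H_series"
proof -
  have inv: "H_series_scaled * fps_right_inverse H_series_scaled 1 = 1"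
    by (rule fps_right_inverse) (simp add: H_series_scaled_def)
  have "cyclic_series * H_series_scaled =
        H_series * (H_series_scaled * fps_right_inverse H_series_scaled 1)"
    unfolding cyclic_series_def by (simp only: mult_ac)
  then show ?thesis by (simp only: inv mult_1_right)
qed

lemma cyclic_series_eq: "cyclic_series = 1 + Abs_fps (\<lambda>n. if n \<ge> 1 then cyclic_sf n else 0)"
  by (rule fps_ext) (auto simp: cyclic_sf_def cyclic_series_def not_le)

subsection \<open>Coproduct and primitive elements\<close>

text \<open>\<open>f \<otimes> g\<close> in \<open>\<Lambda> \<otimes> \<Lambda>\<close>, the first factor being the ring of coefficients.\<close>

definition sf_tensor :: "rat symfun \<Rightarrow> rat symfun \<Rightarrow> rat symfun symfun" where
  "sf_tensor f g = sf_const f * sf_map sf_const g"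

lemma sf_coeff_tensor: "sf_coeff (sf_coeff (sf_tensor f g) l) k = sf_coeff f k * sf_coeff g l"
  by (simp add: sf_tensor_def sf_coeff_const_mult sf_coeff_map mult.commute[of f])

definition is_coproduct :: "(rat symfun \<Rightarrow> rat symfun symfun) \<Rightarrow> bool" where
  "is_coproduct \<Delta> \<longleftrightarrow>
     \<Delta> 1 = sf_tensor 1 1 \<and>
     (\<forall>f g. \<Delta> (f + g) = \<Delta> f + \<Delta> g) \<and>
     (\<forall>f g. \<Delta> (f * g) = \<Delta> f * \<Delta> g) \<and>
     (\<forall>q f. \<Delta> (sf_const q * f) = sf_const (sf_const q) * \<Delta> f) \<and>
     (\<forall>n\<ge>1. \<Delta> (psum n) = sf_tensor (psum n) 1 + sf_tensor 1 (psum n))"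

text \<open>
  There is exactly one such map, because the power sums generate the algebra \<open>\<Lambda>\<close>; only its
  existence is shown below.
\<close>

definition coproduct :: "rat symfun \<Rightarrow> rat symfun symfun" where
  "coproduct = (SOME \<Delta>. is_coproduct \<Delta>)"

definition primitive :: "rat symfun \<Rightarrow> bool" where
  "primitive f \<longleftrightarrow> coproduct f = sf_tensor f 1 + sf_tensor 1 f"

text \<open>
  For the existence, the two families of variables are interleaved: \<open>\<Delta> f\<close> is \<open>f\<close> with the
  even variables regarded as the first family and the odd variables as the second.
\<close>

definition merge :: "nat multiset \<Rightarrow> nat multiset \<Rightarrow> nat multiset" where
  "merge k l = image_mset (\<lambda>i. 2 * i) k + image_mset (\<lambda>i. 2 * i + 1) l"

definition evens :: "nat multiset \<Rightarrow> nat multiset" where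
  "evens m = image_mset (\<lambda>i. i div 2) (filter_mset even m)"

definition odds :: "nat multiset \<Rightarrow> nat multiset" where
  "odds m = image_mset (\<lambda>i. i div 2) (filter_mset odd m)"

lemma size_merge [simp]: "size (merge k l) = size k + size l"
  by (simp add: merge_def)

lemma merge_add: "merge (k + k') (l + l') = merge k l + merge k' l'"
  by (simp add: merge_def)

lemma evens_add: "evens (a + b) = evens a + evens b"
  by (simp add: evens_def)

lemma odds_add: "odds (a + b) = odds a + odds b"
  by (simp add: odds_def)

lemma evens_merge [simp]: "evens (merge k l) = k"
proof -
  have "evens (image_mset (\<lambda>i. 2 * i) k) = k" by (induction k) (auto simp: evens_def)
  moreover have "evens (image_mset (\<lambda>i. 2 * i + 1) l) = {#}" by (induction l) (auto simp: evens_def)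
  ultimately show ?thesis by (simp only: merge_def evens_add) simp
qed

lemma odds_merge [simp]: "odds (merge k l) = l"
proof -
  have "odds (image_mset (\<lambda>i. 2 * i) k) = {#}" by (induction k) (auto simp: odds_def)
  moreover have "odds (image_mset (\<lambda>i. 2 * i + 1) l) = l" by (induction l) (auto simp: odds_def)
  ultimately show ?thesis by (simp only: merge_def odds_add) simp
qed

lemma merge_evens_odds [simp]: "merge (evens m) (odds m) = m"
  by (induction m) (auto simp: merge_def evens_def odds_def)

lemma merge_image:
  assumes "bij \<sigma>" "bij \<tau>"
  obtains \<rho> where "bij \<rho>" "\<And>k l. merge (image_mset \<sigma> k) (image_mset \<tau> l) = image_mset \<rho> (merge k l)"
proof
  let ?r = "\<lambda>\<sigma> \<tau> i. if even i then 2 * \<sigma> (i div 2) else 2 * \<tau> (i div 2) + 1 :: nat"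
  have "?r \<sigma> \<tau> (?r (inv \<sigma>) (inv \<tau>) i) = i" "?r (inv \<sigma>) (inv \<tau>) (?r \<sigma> \<tau> i) = i" for i
    using assms by (auto simp: bij_is_surj surj_f_inv_f bij_is_inj inv_f_f)
  then show "bij (?r \<sigma> \<tau>)"
    by (intro bij_betw_byWitness[of _ "?r (inv \<sigma>) (inv \<tau>)"]) auto
  show "merge (image_mset \<sigma> k) (image_mset \<tau> l) = image_mset (?r \<sigma> \<tau>) (merge k l)" for k l
    by (simp add: merge_def multiset.map_comp o_def)
qed

lift_definition sf_slice :: "'a :: comm_ring_1 symfun \<Rightarrow> nat multiset \<Rightarrow> 'a symfun" is
  "\<lambda>f l. Abs_mseries (\<lambda>k. mcoeff f (merge k l))"
proof (elim conjE exE, intro CollectI conjI allI impI)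
  fix f :: "'a mseries" and l m :: "nat multiset" and \<sigma> :: "nat \<Rightarrow> nat"
  assume sym: "\<forall>\<sigma> m. bij \<sigma> \<longrightarrow> mcoeff f (image_mset \<sigma> m) = mcoeff f m" and "bij \<sigma>"
  then obtain \<rho> where "bij \<rho>" "\<And>k l. merge (image_mset \<sigma> k) (image_mset id l) = image_mset \<rho> (merge k l)"
    using merge_image[OF _ bij_id] by blast
  with sym show "mcoeff (Abs_mseries (\<lambda>k. mcoeff f (merge k l))) (image_mset \<sigma> m) =
                 mcoeff (Abs_mseries (\<lambda>k. mcoeff f (merge k l))) m"
    by (metis mcoeff_Abs multiset.map_id)
next
  fix f :: "'a mseries" and l :: "nat multiset" and d
  assume "\<forall>m. size m > d \<longrightarrow> mcoeff f m = 0"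
  then show "\<exists>d. \<forall>m. size m > d \<longrightarrow> mcoeff (Abs_mseries (\<lambda>k. mcoeff f (merge k l))) m = 0"
    by (intro exI[of _ d]) auto
qed

lemma sf_coeff_slice: "sf_coeff (sf_slice f l) k = sf_coeff f (merge k l)"
  unfolding sf_coeff_def by transfer simp

definition interleave :: "'a :: comm_ring_1 symfun \<Rightarrow> 'a symfun symfun" where
  "interleave f = Abs_symfun (Abs_mseries (sf_slice f))"

lemma sf_coeff_interleave: "sf_coeff (sf_coeff (interleave f) l) k = sf_coeff f (merge k l)"
proof -
  have "series_of (Abs_symfun (Abs_mseries (sf_slice f))) = Abs_mseries (sf_slice f)"
  proof (rule Abs_symfun_inverse, intro CollectI conjI allI impI)
    fix \<sigma> :: "nat \<Rightarrow> nat" and m assume "bij \<sigma>"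
    then obtain \<rho> where \<rho>: "bij \<rho>"
      "\<And>k l. merge (image_mset id k) (image_mset \<sigma> l) = image_mset \<rho> (merge k l)"
      using merge_image[OF bij_id] by blast
    have "sf_slice f (image_mset \<sigma> m) = sf_slice f m"
      using \<rho>(2)[of _ m] sf_coeff_sym[OF \<rho>(1)] by (intro symfun_eqI) (simp add: sf_coeff_slice)
    then show "mcoeff (Abs_mseries (sf_slice f)) (image_mset \<sigma> m) = mcoeff (Abs_mseries (sf_slice f)) m"
      by simp
  next
    obtain d where "\<forall>m. size m > d \<longrightarrow> sf_coeff f m = 0" using sf_coeff_bounded by blast
    then show "\<exists>d. \<forall>m. size m > d \<longrightarrow> mcoeff (Abs_mseries (sf_slice f)) m = 0"
      by (intro exI[of _ d]) (auto intro!: symfun_eqI simp: sf_coeff_slice)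
  qed
  then have "sf_coeff (interleave f) l = sf_slice f l"
    by (simp add: sf_coeff_def interleave_def)
  then show ?thesis by (simp add: sf_coeff_slice)
qed

lemma interleave_mult: "interleave (f * g) = interleave f * interleave g"
proof (rule symfun_eqI, rule symfun_eqI)
  fix l k
  let ?c = "\<lambda>f k l. sf_coeff f (merge k l)"
  have "sf_coeff (sf_coeff (interleave (f * g)) l) k =
        (\<Sum>(a, b)\<in>msplits (merge k l). sf_coeff f a * sf_coeff g b)"
    by (simp add: sf_coeff_interleave sf_coeff_mult)
  also have "\<dots> = (\<Sum>((l1, l2), (k1, k2))\<in>msplits l \<times> msplits k. ?c f k1 l1 * ?c g k2 l2)"
  proof (rule sum.reindex_bij_witness
      [where j = "\<lambda>(a, b). ((odds a, odds b), (evens a, evens b))"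
         and i = "\<lambda>((l1, l2), (k1, k2)). (merge k1 l1, merge k2 l2)"])
    fix x assume "x \<in> msplits (merge k l)"
    then have "fst x + snd x = merge k l" by (auto simp: msplits_def)
    then have "evens (fst x) + evens (snd x) = k" "odds (fst x) + odds (snd x) = l"
      by (metis evens_add evens_merge, metis odds_add odds_merge)
    then show "(case x of (a, b) \<Rightarrow> ((odds a, odds b), evens a, evens b)) \<in> msplits l \<times> msplits k"
      by (auto simp: msplits_def split_beta)
  qed (auto simp: msplits_def merge_add)
  also have "\<dots> = (\<Sum>(l1, l2)\<in>msplits l. \<Sum>(k1, k2)\<in>msplits k. ?c f k1 l1 * ?c g k2 l2)"
    by (simp add: sum.cartesian_product split_beta)
  also have "\<dots> = sf_coeff (sf_coeff (interleave f * interleave g) l) k"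
    by (simp add: sf_coeff_mult sf_coeff_sum sf_coeff_interleave split_beta)
  finally show "sf_coeff (sf_coeff (interleave (f * g)) l) k =
                sf_coeff (sf_coeff (interleave f * interleave g) l) k" .
qed

lemma merge_eq_replicate_iff:
  assumes "n \<ge> 1"
  shows "(\<exists>i. merge k l = replicate_mset n i) \<longleftrightarrow>
           (\<exists>i. k = replicate_mset n i) \<and> l = {#} \<or> k = {#} \<and> (\<exists>i. l = replicate_mset n i)"
proof
  assume "\<exists>i. merge k l = replicate_mset n i"
  then obtain i where i: "merge k l = replicate_mset n i" by blast
  have "k = evens (replicate_mset n i)" "l = odds (replicate_mset n i)"
    by (simp_all flip: i)
  moreover have "evens (replicate_mset n i) = (if even i then replicate_mset n (i div 2) else {#})"
    "odds (replicate_mset n i) = (if even i then {#} else replicate_mset n (i div 2))"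
    by (induction n) (auto simp: evens_def odds_def)
  ultimately show "(\<exists>i. k = replicate_mset n i) \<and> l = {#} \<or> k = {#} \<and> (\<exists>i. l = replicate_mset n i)"
    by auto
qed (auto simp: merge_def)

lemma is_coproduct_interleave: "is_coproduct interleave"
  unfolding is_coproduct_def
proof (intro conjI allI impI)
  show "interleave 1 = sf_tensor 1 1"
    by (intro symfun_eqI) (auto simp: sf_coeff_interleave sf_coeff_tensor sf_coeff_1 merge_def)
  show "interleave (f + g) = interleave f + interleave g" for f g :: "rat symfun"
    by (intro symfun_eqI) (simp add: sf_coeff_interleave)
  show "interleave (sf_const q * f) = sf_const (sf_const q) * interleave f" for q and f :: "rat symfun"
    by (intro symfun_eqI) (simp add: sf_coeff_interleave sf_coeff_const_mult)
  show "interleave (psum n) = sf_tensor (psum n) 1 + sf_tensor 1 (psum n)" if "n \<ge> 1" for n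
    using that
    by (intro symfun_eqI)
       (auto simp: sf_coeff_interleave sf_coeff_tensor sf_coeff_psum sf_coeff_1 merge_eq_replicate_iff)
qed (rule interleave_mult)

lemma is_coproduct_coproduct: "is_coproduct coproduct"
  unfolding coproduct_def by (metis is_coproduct_interleave someI_ex)


section \<open>Partitions\<close>

text \<open>
  A partition is the multiset of its parts: \<open>count \<mu> i\<close> is the multiplicity \<open>m\<^sub>i(\<mu>)\<close> and
  \<open>size \<mu>\<close> is the length.
\<close>

definition partitions_of :: "nat \<Rightarrow> nat multiset set" where
  "partitions_of n = {\<mu>. 0 \<notin># \<mu> \<and> sum_mset \<mu> = n}"

lemma finite_partitions_of: "finite (partitions_of n)"
proof (rule finite_subset)
  show "partitions_of n \<subseteq> (\<Union>k\<le>n. multisets_of_size {..n} k)"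
  proof
    fix \<mu> assume *: "\<mu> \<in> partitions_of n"
    have "0 \<notin># \<nu> \<Longrightarrow> size \<nu> \<le> sum_mset \<nu>" for \<nu> :: "nat multiset"
      by (induction \<nu>) auto
    with * have "size \<mu> \<le> n" by (auto simp: partitions_of_def)
    moreover have "i \<le> n" if "i \<in># \<mu>" for i
      using that * by (auto simp: partitions_of_def dest!: multi_member_split)
    ultimately show "\<mu> \<in> (\<Union>k\<le>n. multisets_of_size {..n} k)"
      by (auto simp: multisets_of_size_def)
  qed
  show "finite (\<Union>k\<le>n. multisets_of_size {..n} k)"
    by (intro finite_UN_I finite_multisets_of_size finite_atMost)
qed

text \<open>The multinomial coefficient; the division is exact.\<close>

definition multinomial :: "nat \<Rightarrow> nat multiset \<Rightarrow> nat" where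
  "multinomial n \<mu> = fact (size \<mu>) div (\<Prod>i=1..n. fact (count \<mu> i))"

definition cyclic_prod :: "nat \<Rightarrow> nat multiset \<Rightarrow> rat poly symfun" where
  "cyclic_prod n \<mu> = (\<Prod>i=1..n. cyclic_sf i ^ count \<mu> i)"

definition t_fract :: "rat poly fract" where
  "t_fract = to_fract [:0, 1:]"

end

theory Submission
  imports Defs "HOL-Combinatorics.Multiset_Permutations"
begin

text \<open>
  Write \<open>C(T) = H(T) / H(tT)\<close> and \<open>\<theta> = T d/dT\<close>. The formula compares two ways of computing
  the coefficients of \<open>\<theta> log C\<close>.

  On the one hand, Newton's identities say that \<open>\<theta> H = H \<cdot> \<Sum> p\<^sub>n T\<^sup>n\<close> (lemma \<open>newton_identity\<close>).
  Substituting \<open>tT\<close> for \<open>T\<close> and using the product rule on \<open>C(T) H(tT) = H(T)\<close> gives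
  \<open>\<theta> C = C \<cdot> \<Sum> (1 - t\<^sup>n) p\<^sub>n T\<^sup>n\<close> (lemma \<open>cyclic_series_logarithmic_derivative\<close>).
  On the other hand, \<open>\<theta> log C\<close> can be read off from \<open>log C = \<Sum> (-1)\<^sup>l\<^sup>+\<^sup>1 (C - 1)\<^sup>l / l\<close>
  (lemma \<open>fps_nth_logarithmic_derivative\<close>). Expanding the \<open>l\<close>-th power of
  \<open>C - 1 = \<Sum> c\<^sub>n T\<^sup>n\<close> yields a sum over compositions of \<open>n\<close> into \<open>l\<close> parts, and a partition
  arises from as many compositions as its parts have rearrangements, which is the multinomial
  coefficient (lemma \<open>fps_power_nth_partitions\<close>).

  All of this happens over the polynomials in \<open>t\<close>, where it determines \<open>(1 - t\<^sup>n) p\<^sub>n\<close>; passing to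
  the field of fractions serves only to divide by \<open>1 - t\<^sup>n\<close>. The power sums are primitive
  because the coproduct is characterised by making them so.
\<close>

section \<open>Logarithmic derivatives of power series\<close>

lemma fps_XD_mult: "fps_XD (f * g) = fps_XD f * g + f * fps_XD (g :: 'a :: comm_ring_1 fps)"
  by (simp add: fps_XD_def algebra_simps)

text \<open>
  A logarithmic derivative can be computed after substituting \<open>cT\<close> for \<open>T\<close>, because this
  substitution is multiplicative and commutes with \<open>T d/dT\<close>: it multiplies the coefficient of
  \<open>T\<^sup>n\<close> by \<open>c\<^sup>n\<close>.
\<close>

lemma fps_XD_compose_linear:
  fixes f q :: "'a :: comm_ring_1 fps" and c :: 'a
  assumes "fps_XD f = f * q"
  defines "s \<equiv> fps_const c * fps_X"
  shows "fps_XD (f oo s) = (f oo s) * (q oo s)"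
proof (rule fps_ext)
  fix n
  have "fps_XD (f oo s) $ n = c ^ n * fps_XD f $ n"
    unfolding fps_XD_nth s_def fps_nth_compose_linear by (simp only: mult_ac)
  also have "\<dots> = (\<Sum>i=0..n. c ^ n * (f $ i * q $ (n - i)))"
    by (simp add: assms(1) fps_mult_nth sum_distrib_left)
  also have "\<dots> = ((f oo s) * (q oo s)) $ n"
    unfolding fps_mult_nth s_def fps_nth_compose_linear
  proof (rule sum.cong)
    fix i assume "i \<in> {0..n}"
    then have "c ^ n = c ^ i * c ^ (n - i)" by (simp flip: power_add)
    then show "c ^ n * (f $ i * q $ (n - i)) = c ^ i * f $ i * (c ^ (n - i) * q $ (n - i))"
      by (simp add: mult_ac)
  qed simp
  finally show "fps_XD (f oo s) $ n = ((f oo s) * (q oo s)) $ n" .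
qed

text \<open>
  This is \<open>q = \<theta> log f\<close> with the logarithm expanded in powers of \<open>d = f - 1\<close>. Truncation after
  \<open>n\<close> terms makes it a finite computation: \<open>\<theta> (d\<^sup>l) = l d\<^sup>l\<^sup>-\<^sup>1 (1 + d) q\<close>, so the
  sum becomes a geometric one with value \<open>q (1 - (-d)\<^sup>n)\<close>, and the error term starts in degree
  \<open>n + 1\<close>. The elements \<open>r l\<close> stand for \<open>1 / l\<close> in a ring without division.
\<close>

lemma fps_nth_logarithmic_derivative:
  fixes f q :: "'a :: comm_ring_1 fps" and r :: "nat \<Rightarrow> 'a"
  assumes f0: "f $ 0 = 1" and q: "fps_XD f = f * q"
    and r: "\<And>l. l \<ge> 1 \<Longrightarrow> of_nat l * r l = 1"
  shows "q $ n = of_nat n * (\<Sum>l=1..n. (-1) ^ (l + 1) * r l * ((f - 1) ^ l) $ n)"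
proof -
  define d where "d = f - 1"
  have f: "f = 1 + d" by (simp add: d_def)
  have d0: "d $ 0 = 0" by (simp add: d_def f0)
  have XDd: "fps_XD d = (1 + d) * q"
    using q by (simp add: f fps_XD_def)
  have step: "of_nat n * (r l * (d ^ l) $ n) = ((1 + d) * q * d ^ (l - 1)) $ n" if "l \<ge> 1" for l
  proof -
    have "fps_XD (d ^ l) = of_nat l * (fps_XD d * d ^ (l - 1))"
      by (simp add: fps_XD_def fps_deriv_power' mult_ac)
    then have "of_nat n * (d ^ l) $ n = of_nat l * ((1 + d) * q * d ^ (l - 1)) $ n"
      unfolding XDd fps_XD_nth[symmetric] by (simp add: fps_of_nat[symmetric])
    then have "r l * (of_nat n * (d ^ l) $ n) = (of_nat l * r l) * ((1 + d) * q * d ^ (l - 1)) $ n"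
      by (simp add: mult_ac)
    then show ?thesis using r[OF that] by (simp add: mult_ac)
  qed
  have "of_nat n * (\<Sum>l=1..n. (-1) ^ (l + 1) * r l * (d ^ l) $ n) =
        (\<Sum>l=1..n. (-1) ^ (l + 1) * ((1 + d) * q * d ^ (l - 1)) $ n)"
    unfolding sum_distrib_left
  proof (intro sum.cong refl)
    fix l assume "l \<in> {1..n}"
    then have "of_nat n * (r l * (d ^ l) $ n) = ((1 + d) * q * d ^ (l - 1)) $ n"
      by (intro step) simp
    then show "of_nat n * ((-1) ^ (l + 1) * r l * (d ^ l) $ n) =
        (-1) ^ (l + 1) * ((1 + d) * q * d ^ (l - 1)) $ n"
      by (metis mult.left_commute mult.assoc)
  qed
  also have "\<dots> = (\<Sum>j<n. (-1) ^ j * ((1 + d) * q * d ^ j) $ n)"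
    by (rule sum.reindex_bij_witness[of _ Suc "\<lambda>l. l - 1"]) (auto simp: Suc_le_eq gr0_conv_Suc)
  also have "\<dots> = (\<Sum>j<n. ((1 + d) * q * (- d) ^ j) $ n)"
  proof (rule sum.cong)
    fix j
    have "(- d) ^ j = fps_const ((-1) ^ j) * d ^ j"
      by (cases "even j") (simp_all flip: fps_const_neg)
    then have "(1 + d) * q * (- d) ^ j = fps_const ((-1) ^ j) * ((1 + d) * q * d ^ j)"
      by (simp add: mult_ac)
    then show "(-1) ^ j * ((1 + d) * q * d ^ j) $ n = ((1 + d) * q * (- d) ^ j) $ n"
      by simp
  qed simp
  also have "\<dots> = (q * ((1 - (- d)) * (\<Sum>j<n. (- d) ^ j))) $ n"
    by (simp add: sum_distrib_left fps_sum_nth mult_ac)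
  also have "\<dots> = (q * (1 - (- d) ^ n)) $ n"
    by (simp only: one_diff_power_eq)
  also have "\<dots> = q $ n"
  proof -
    \<comment> \<open>\<open>d\<^sup>n\<close> has order at least \<open>n\<close>, and \<open>q\<close> has order at least 1, which is what kills degree \<open>n\<close>.\<close>
    have q0: "q $ 0 = 0" using arg_cong[OF q, of "\<lambda>g. g $ 0"] f0 by (simp add: fps_XD_nth)
    have "(q * (- d) ^ n) $ n = 0"
      unfolding fps_mult_nth
    proof (intro sum.neutral ballI)
      fix i assume "i \<in> {0..n}"
      then show "q $ i * ((- d) ^ n) $ (n - i) = 0"
        using startsby_zero_power_prefix[of "- d" n] d0 q0 by (cases "i = 0") auto
    qed
    then show ?thesis by (simp add: right_diff_distrib)
  qed
  finally show ?thesis by (simp add: d_def)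
qed

section \<open>Powers of a series as sums over partitions\<close>

lemma partitions_of_subset: "\<mu> \<in> partitions_of n \<Longrightarrow> set_mset \<mu> \<subseteq> {1..n}"
  by (auto simp: partitions_of_def Suc_le_eq intro!: gr0I dest!: multi_member_split)

lemma multinomial_eq_card:
  assumes "\<mu> \<in> partitions_of n"
  shows "multinomial n \<mu> = card (permutations_of_multiset \<mu>)"
proof -
  have "(\<Prod>i=1..n. fact (count \<mu> i) :: nat) = (\<Prod>i\<in>set_mset \<mu>. fact (count \<mu> i))"
    using partitions_of_subset[OF assms]
    by (intro prod.mono_neutral_right) (auto simp: not_in_iff)
  then show ?thesis
    by (simp add: multinomial_def card_permutations_of_multiset(1))
qed

text \<open>
  The coefficient is a sum over all lists of \<open>l\<close> exponents with sum \<open>n\<close>. Lists containing 0 do not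
  contribute as \<open>d $ 0 = 0\<close>, and the summand depends only on the underlying multiset, so that the
  remaining lists can be grouped by partitions.
\<close>

lemma fps_power_nth_partitions:
  fixes d :: "'a :: comm_ring_1 fps"
  assumes d0: "d $ 0 = 0" and l: "l \<ge> 1"
  shows "(d ^ l) $ n = (\<Sum>\<mu> | \<mu> \<in> partitions_of n \<and> size \<mu> = l.
           of_nat (multinomial n \<mu>) * (\<Prod>i=1..n. (d $ i) ^ count \<mu> i))"
proof -
  let ?L = "{v. mset v \<in> partitions_of n \<and> length v = l}"
  let ?M = "{\<mu>. \<mu> \<in> partitions_of n \<and> size \<mu> = l}"
  have finM: "finite ?M" using finite_partitions_of by simp
  have LM: "?L = (\<Union>\<mu>\<in>?M. permutations_of_multiset \<mu>)"
    by (auto simp: permutations_of_multiset_def)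
  have "(d ^ l) $ n = (\<Sum>v\<in>natpermute n l. \<Prod>j\<in>{0..l - 1}. d $ (v ! j))"
    using l by (simp add: fps_power_nth)
  also have "\<dots> = (\<Sum>v\<in>natpermute n l. prod_mset (image_mset (($) d) (mset v)))"
  proof (rule sum.cong)
    fix v assume "v \<in> natpermute n l"
    then have "length v = l" by (simp add: natpermute_def)
    then have "prod_list (map (($) d) v) = (\<Prod>j\<in>{0..<l}. d $ (v ! j))"
      by (simp add: prod.list_conv_set_nth)
    also have "{0..<l} = {0..l - 1}" using l by auto
    finally show "(\<Prod>j\<in>{0..l - 1}. d $ (v ! j)) = prod_mset (image_mset (($) d) (mset v))"
      by (metis mset_map prod_mset_prod_list)
  qed simp
  also have "\<dots> = (\<Sum>v\<in>?L. prod_mset (image_mset (($) d) (mset v)))"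
  proof (rule sum.mono_neutral_right[OF natpermute_finite])
    show "?L \<subseteq> natpermute n l"
      by (auto simp: natpermute_def partitions_of_def sum_mset_sum_list)
    show "\<forall>v\<in>natpermute n l - ?L. prod_mset (image_mset (($) d) (mset v)) = 0"
    proof
      fix v assume "v \<in> natpermute n l - ?L"
      then have "0 \<in># mset v"
        by (auto simp: natpermute_def partitions_of_def sum_mset_sum_list)
      then obtain M where "mset v = add_mset 0 M" by (metis insert_DiffM)
      then show "prod_mset (image_mset (($) d) (mset v)) = 0" using d0 by simp
    qed
  qed
  also have "\<dots> = (\<Sum>\<mu>\<in>?M. \<Sum>v\<in>permutations_of_multiset \<mu>. prod_mset (image_mset (($) d) (mset v)))"
    unfolding LM using finM
    by (intro sum.UNION_disjoint) (auto dest: permutations_of_multisetD)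
  also have "\<dots> = (\<Sum>\<mu>\<in>?M. of_nat (multinomial n \<mu>) * (\<Prod>i=1..n. (d $ i) ^ count \<mu> i))"
  proof (rule sum.cong)
    fix \<mu> assume "\<mu> \<in> ?M"
    then have \<mu>: "\<mu> \<in> partitions_of n" by simp
    have "(\<Sum>v\<in>permutations_of_multiset \<mu>. prod_mset (image_mset (($) d) (mset v))) =
          (\<Sum>v\<in>permutations_of_multiset \<mu>. prod_mset (image_mset (($) d) \<mu>))"
      by (intro sum.cong) (auto simp: permutations_of_multiset_def)
    also have "\<dots> = of_nat (multinomial n \<mu>) * prod_mset (image_mset (($) d) \<mu>)"
      by (simp add: multinomial_eq_card[OF \<mu>])
    also have "prod_mset (image_mset (($) d) \<mu>) = (\<Prod>i\<in>set_mset \<mu>. (d $ i) ^ count \<mu> i)"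
      by (rule prod_mset_multiplicity[of "image_mset _ _", simplified] image_prod_mset_multiplicity)+
    also have "\<dots> = (\<Prod>i=1..n. (d $ i) ^ count \<mu> i)"
      using partitions_of_subset[OF \<mu>]
      by (intro prod.mono_neutral_left) (auto simp: not_in_iff)
    finally show "(\<Sum>v\<in>permutations_of_multiset \<mu>. prod_mset (image_mset (($) d) (mset v))) =
                  of_nat (multinomial n \<mu>) * (\<Prod>i=1..n. (d $ i) ^ count \<mu> i)" .
  qed simp
  finally show ?thesis .
qed

section \<open>Newton's identities\<close>

definition psum_series :: "'a :: comm_ring_1 symfun fps" where
  "psum_series = Abs_fps (\<lambda>n. if n = 0 then 0 else psum n)"

text \<open>
  The divisors of a monomial that are powers \<open>X\<^sub>j\<^sup>k\<close> with \<open>k \<ge> 1\<close>: the variable \<open>X\<^sub>j\<close> admits as many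
  exponents as its multiplicity, so there are as many as the degree of the monomial.
\<close>

lemma card_power_divisors:
  "card {(a, b) \<in> msplits m. b \<noteq> {#} \<and> (\<exists>j. b = replicate_mset (size b) j)} = size m"
proof -
  let ?S = "SIGMA j:set_mset m. {1..count m j}"
  let ?B = "{(a, b) \<in> msplits m. b \<noteq> {#} \<and> (\<exists>j. b = replicate_mset (size b) j)}"
  have "bij_betw (\<lambda>(j, k). (m - replicate_mset k j, replicate_mset k j)) ?S ?B"
    unfolding bij_betw_def
  proof (intro conjI equalityI subsetI)
    show "inj_on (\<lambda>(j, k). (m - replicate_mset k j, replicate_mset k j)) ?S"
    proof (rule inj_onI, clarify)
      fix i j k k' assume *: "replicate_mset k i = replicate_mset k' j"
        and k: "k \<in> {1..count m i}"
      have "i \<in># replicate_mset k i" using k by simp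
      then have "i = j" unfolding * by (simp split: if_splits)
      moreover have "k = k'" using arg_cong[OF *, of size] by simp
      ultimately show "i = j \<and> k = k'" by blast
    qed
    fix x assume "x \<in> (\<lambda>(j, k). (m - replicate_mset k j, replicate_mset k j)) ` ?S"
    then obtain j k where x: "x = (m - replicate_mset k j, replicate_mset k j)"
      and k: "k \<ge> 1" "k \<le> count m j" by auto
    then have "replicate_mset k j \<subseteq># m" by (simp add: count_le_replicate_mset_subset_eq)
    then have "(m - replicate_mset k j) + replicate_mset k j = m"
      by (rule subset_mset.diff_add)
    then have "(m - replicate_mset k j, replicate_mset k j) \<in> msplits m"
      by (simp add: msplits_def)
    moreover have "replicate_mset k j \<noteq> {#}" using k(1) by simp
    moreover have "replicate_mset k j = replicate_mset (size (replicate_mset k j)) j"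
      by (simp only: size_replicate_mset)
    ultimately show "x \<in> ?B" unfolding x by blast
  next
    fix x assume "x \<in> ?B"
    then obtain a b j where x: "x = (a, b)" and ab: "(a, b) \<in> msplits m"
      and b: "b \<noteq> {#}" and bj: "b = replicate_mset (size b) j"
      by blast
    have m: "a + b = m" using ab by (simp add: msplits_def)
    define k where "k = size b"
    have bk: "b = replicate_mset k j" unfolding k_def by (rule bj)
    have k1: "k \<ge> 1" using b by (simp add: k_def Suc_le_eq nonempty_has_size)
    have kc: "k \<le> count m j" unfolding m[symmetric] bk by simp
    with k1 have "j \<in># m" by (intro count_inI) simp
    with k1 kc have "(j, k) \<in> ?S" by simp
    moreover have "x = (m - replicate_mset k j, replicate_mset k j)"
      unfolding x m[symmetric] bk by simp
    ultimately show "x \<in> (\<lambda>(j, k). (m - replicate_mset k j, replicate_mset k j)) ` ?S"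
      by (intro image_eqI[of _ _ "(j, k)"]) simp_all
  qed
  then have "card ?S = card ?B" by (rule bij_betw_same_card)
  then have "card ?B = card ?S" by (rule sym)
  also have "\<dots> = size m" by (simp add: size_multiset_overloaded_eq)
  finally show ?thesis .
qed

text \<open>
  In degree \<open>n\<close> this is \<open>n h\<^sub>n = \<Sum> h\<^sub>n\<^sub>-\<^sub>k p\<^sub>k\<close>. Since every coefficient of \<open>h\<^sub>n\<close> is 1, the
  coefficient on the right of a monomial of degree \<open>n\<close> is the number of its divisors of the form
  \<open>X\<^sub>j\<^sup>k\<close> with \<open>k \<ge> 1\<close>.
\<close>

lemma newton_identity: "fps_XD H_series = H_series * (psum_series :: 'a :: comm_ring_1 symfun fps)"
proof (rule fps_ext, rule symfun_eqI)
  fix n m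
  let ?P = "\<lambda>b. b \<noteq> {#} \<and> (\<exists>j. b = replicate_mset (size b) j) :: bool"
  have inner: "(\<Sum>i=0..n. sf_coeff (H_series $ i) a * sf_coeff (psum_series $ (n - i)) b :: 'a) =
      (if size m = n \<and> ?P b then 1 else 0)" if ab: "(a, b) \<in> msplits m" for a b
  proof -
    have m: "m = a + b" using ab by (simp add: msplits_def)
    have coeff: "sf_coeff (psum_series $ k) b = (if size b = k \<and> ?P b then 1 else (0 :: 'a))" for k
      by (cases "k = 0") (auto simp: psum_series_def sf_coeff_psum)
    have "(\<Sum>i=0..n. sf_coeff (H_series $ i) a * sf_coeff (psum_series $ (n - i)) b :: 'a) =
          (\<Sum>i=0..n. if i = size a then if size b = n - i \<and> ?P b then 1 else 0 else 0)"
      by (intro sum.cong refl) (auto simp: sf_coeff_H_series coeff)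
    also have "\<dots> = (if size m = n \<and> ?P b then 1 else 0)"
      by (auto simp: m)
    finally show ?thesis .
  qed
  have "sf_coeff ((H_series * psum_series) $ n) m =
        (\<Sum>i=0..n. \<Sum>(a, b)\<in>msplits m. sf_coeff (H_series $ i) a * sf_coeff (psum_series $ (n - i)) b :: 'a)"
    by (simp add: fps_mult_nth sf_coeff_sum sf_coeff_mult)
  also have "\<dots> = (\<Sum>(a, b)\<in>msplits m. \<Sum>i=0..n. sf_coeff (H_series $ i) a * sf_coeff (psum_series $ (n - i)) b)"
    by (subst sum.swap) (simp add: split_beta)
  also have "\<dots> = (\<Sum>(a, b)\<in>msplits m. if size m = n \<and> ?P b then 1 else 0)"
    by (intro sum.cong) (auto simp: inner)
  also have "\<dots> = (if size m = n then of_nat (card {(a, b) \<in> msplits m. ?P b}) else 0)"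
    by (auto simp: split_beta sum.If_cases Int_def intro!: arg_cong[of _ _ of_nat] arg_cong[of _ _ card])
  also have "\<dots> = (if size m = n then of_nat n else 0)"
    by (simp only: card_power_divisors) auto
  also have "\<dots> = sf_coeff (fps_XD H_series $ n) m"
  proof -
    have "sf_coeff (of_nat k * f) m = of_nat k * sf_coeff f m" for k and f :: "'a symfun"
      by (induction k) (simp_all add: distrib_right)
    then show ?thesis by (simp add: fps_XD_nth sf_coeff_H_series)
  qed
  finally show "(sf_coeff (fps_XD H_series $ n) m :: 'a) = sf_coeff ((H_series * psum_series) $ n) m"
    by (rule sym)
qed

section \<open>The power sums in terms of the cyclic symmetric functions\<close>

lemma cyclic_series_logarithmic_derivative:
  "fps_XD cyclic_series =
     cyclic_series * (psum_series - (psum_series oo (fps_const (sf_const [:0, 1:]) * fps_X)))"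
proof -
  let ?s = "fps_const (sf_const [:0, 1:]) * fps_X :: rat poly symfun fps"
  let ?K = "fps_right_inverse H_series_scaled 1"
  have K: "H_series_scaled * ?K = 1"
    by (rule fps_right_inverse) (simp add: H_series_scaled_def)
  have scaled: "fps_XD H_series_scaled = H_series_scaled * (psum_series oo ?s)"
    unfolding H_series_scaled_def by (rule fps_XD_compose_linear[OF newton_identity])
  have "fps_XD cyclic_series * H_series_scaled + cyclic_series * fps_XD H_series_scaled =
        fps_XD H_series"
    by (simp flip: cyclic_series_mult fps_XD_mult)
  also have "\<dots> = cyclic_series * H_series_scaled * psum_series"
    by (simp add: newton_identity cyclic_series_mult)
  \<comment> \<open>The common factor \<open>H(tT)\<close> is cancelled by multiplying with its inverse.\<close>
  finally have "fps_XD cyclic_series * H_series_scaled =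
      cyclic_series * (psum_series - (psum_series oo ?s)) * H_series_scaled"
    by (simp add: scaled algebra_simps)
  then have "fps_XD cyclic_series * (H_series_scaled * ?K) =
      cyclic_series * (psum_series - (psum_series oo ?s)) * (H_series_scaled * ?K)"
    by (simp only: mult.assoc[symmetric])
  then show ?thesis by (simp only: K mult_1_right)
qed

lemma sf_const_mult: "sf_const (a * b) = sf_const a * sf_const b"
  by (rule symfun_eqI) (simp add: sf_coeff_const_mult sf_coeff_const)

lemma sf_const_power: "sf_const (a ^ k) = sf_const a ^ k"
  by (induction k) (simp_all add: sf_const_mult)

lemma sf_const_diff: "sf_const (a - b) = sf_const a - sf_const b"
  by (rule symfun_eqI) (simp add: sf_coeff_const)

lemma sf_const_minus: "sf_const (- a) = - sf_const a"
  by (rule symfun_eqI) (simp add: sf_coeff_const)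

lemma sf_const_of_nat: "sf_const (of_nat k) = of_nat k"
proof (induction k)
  case (Suc k)
  have "sf_const (of_nat (Suc k)) = 1 + sf_const (of_nat k :: 'a)"
    by (rule symfun_eqI) (simp add: sf_coeff_const sf_coeff_1)
  with Suc show ?case by simp
qed simp

text \<open>
  The formula before division by \<open>1 - t\<^sup>n\<close>, over the polynomials in \<open>t\<close>: the coefficient of
  \<open>T\<^sup>n\<close> in the two expressions for the logarithmic derivative of \<open>H(T) / H(tT)\<close>.
\<close>

lemma psum_eq_sum_cyclic_prod:
  assumes "n \<ge> 1"
  shows "sf_const (1 - [:0, 1:] ^ n) * psum n =
    sf_const (of_nat n) * (\<Sum>\<mu>\<in>partitions_of n.
      sf_const ((-1) ^ (size \<mu> + 1) * [:1 / of_nat (size \<mu>):] * of_nat (multinomial n \<mu>)) *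
      cyclic_prod n \<mu>)"
proof -
  let ?r = "\<lambda>l. sf_const [:1 / of_nat l:] :: rat poly symfun"
  let ?s = "fps_const (sf_const [:0, 1:]) * fps_X :: rat poly symfun fps"
  have C0: "cyclic_series $ 0 = 1" using cyclic_series_eq by (simp add: fps_eq_iff)
  have r: "of_nat l * ?r l = 1" if "l \<ge> 1" for l
    using that by (simp flip: sf_const_of_nat sf_const_mult add: of_nat_poly one_pCons[symmetric])
  have size_bounds: "size \<mu> \<in> {1..n}" if "\<mu> \<in> partitions_of n" for \<mu>
  proof -
    have "0 \<notin># \<nu> \<Longrightarrow> size \<nu> \<le> sum_mset \<nu>" for \<nu> :: "nat multiset"
      by (induction \<nu>) auto
    with that assms show ?thesis
      by (auto simp: partitions_of_def Suc_le_eq intro!: gr0I)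
  qed
  have "sf_const (1 - [:0, 1:] ^ n) * psum n = (psum_series - (psum_series oo ?s)) $ n"
    unfolding fps_sub_nth fps_nth_compose_linear
    using assms by (simp add: psum_series_def sf_const_diff sf_const_power left_diff_distrib)
  also have "\<dots> = of_nat n * (\<Sum>l=1..n. (-1) ^ (l + 1) * ?r l * ((cyclic_series - 1) ^ l) $ n)"
    by (rule fps_nth_logarithmic_derivative[OF C0 cyclic_series_logarithmic_derivative r])
  also have "(\<Sum>l=1..n. (-1) ^ (l + 1) * ?r l * ((cyclic_series - 1) ^ l) $ n) =
     (\<Sum>l=1..n. \<Sum>\<mu> | \<mu> \<in> partitions_of n \<and> size \<mu> = l.
        sf_const ((-1) ^ (size \<mu> + 1) * [:1 / of_nat (size \<mu>):] * of_nat (multinomial n \<mu>)) *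
        cyclic_prod n \<mu>)"
  proof (rule sum.cong)
    fix l assume "l \<in> {1..n}"
    then have "l \<ge> 1" by simp
    have prod: "(\<Prod>i=1..n. ((cyclic_series - 1) $ i) ^ count \<mu> i) = cyclic_prod n \<mu>" for \<mu>
      unfolding cyclic_prod_def cyclic_sf_def by (intro prod.cong) auto
    have "((cyclic_series - 1) ^ l) $ n = (\<Sum>\<mu> | \<mu> \<in> partitions_of n \<and> size \<mu> = l.
        of_nat (multinomial n \<mu>) * cyclic_prod n \<mu>)"
      unfolding prod[symmetric] using C0 \<open>l \<ge> 1\<close> by (intro fps_power_nth_partitions) simp_all
    then show "(-1) ^ (l + 1) * ?r l * ((cyclic_series - 1) ^ l) $ n =
      (\<Sum>\<mu> | \<mu> \<in> partitions_of n \<and> size \<mu> = l.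
        sf_const ((-1) ^ (size \<mu> + 1) * [:1 / of_nat (size \<mu>):] * of_nat (multinomial n \<mu>)) *
        cyclic_prod n \<mu>)"
      by (simp only: sum_distrib_left)
         (intro sum.cong refl, auto simp only: sf_const_mult sf_const_power sf_const_minus
            sf_const_1 sf_const_of_nat mult_ac)
  qed simp
  also have "\<dots> = (\<Sum>\<mu>\<in>partitions_of n.
        sf_const ((-1) ^ (size \<mu> + 1) * [:1 / of_nat (size \<mu>):] * of_nat (multinomial n \<mu>)) *
        cyclic_prod n \<mu>)"
    by (rule sum.group) (use size_bounds finite_partitions_of in auto)
  finally show ?thesis by (simp add: sf_const_of_nat)
qed

lemma to_fract_of_nat: "to_fract (of_nat k) = of_nat k"
  by (induction k) simp_all

lemma to_fract_power: "to_fract (x ^ k) = to_fract x ^ k"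
  by (induction k) simp_all

lemma to_fract_uminus_one_power: "to_fract ((-1) ^ k) = (-1) ^ k"
  by (cases "even k") (simp_all)

lemma to_fract_pCons_inverse_nat:
  assumes "k \<ge> 1"
  shows "to_fract [:1 / of_nat k :: rat:] = 1 / of_nat k"
proof -
  have "of_nat k * [:1 / of_nat k :: rat:] = 1"
    using assms by (simp add: of_nat_poly one_pCons)
  then have "of_nat k * to_fract [:1 / of_nat k :: rat:] = 1"
    by (metis to_fract_1 to_fract_mult to_fract_of_nat)
  moreover from this have "(of_nat k :: rat poly fract) \<noteq> 0"
    by (metis mult_zero_left zero_neq_one)
  ultimately show ?thesis by (simp add: field_simps)
qed

theorem proposition3p1p3:
  fixes n :: nat
  assumes "n \<ge> 1"
  shows "primitive (psum n) \<and>
    (psum n :: rat poly fract symfun) =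
      sf_const (of_nat n / (1 - t_fract ^ n)) *
      (\<Sum>\<mu>\<in>partitions_of n.
         sf_const ((-1) ^ (size \<mu> + 1) * (1 / of_nat (size \<mu>)) * of_nat (multinomial n \<mu>)) *
         sf_map to_fract (cyclic_prod n \<mu>))"
proof
  show "primitive (psum n)"
    using is_coproduct_coproduct assms by (simp add: primitive_def is_coproduct_def)
  let ?w = "\<lambda>\<mu>. (-1) ^ (size \<mu> + 1) * [:1 / of_nat (size \<mu>):] * of_nat (multinomial n \<mu>) :: rat poly"
  let ?v = "\<lambda>\<mu>. (-1) ^ (size \<mu> + 1) * (1 / of_nat (size \<mu>)) * of_nat (multinomial n \<mu>) :: rat poly fract"
  have w: "to_fract (?w \<mu>) = ?v \<mu>" if "\<mu> \<in> partitions_of n" for \<mu>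
  proof -
    have "\<mu> \<noteq> {#}" using that assms by (auto simp: partitions_of_def)
    then have "size \<mu> \<ge> 1" by (simp add: Suc_le_eq nonempty_has_size)
    then show ?thesis
      by (simp only: to_fract_mult to_fract_uminus_one_power to_fract_pCons_inverse_nat to_fract_of_nat)
  qed
  have "degree ([:0, 1:] ^ n :: rat poly) = n" by (simp add: degree_power_eq)
  then have "1 - [:0, 1:] ^ n \<noteq> (0 :: rat poly)"
    using assms by (metis degree_1 eq_iff_diff_eq_0 not_one_le_zero)
  then have nz: "1 - t_fract ^ n \<noteq> 0"
    unfolding t_fract_def by (metis to_fract_1 to_fract_diff to_fract_eq_0_iff to_fract_power)
  show "(psum n :: rat poly fract symfun) = sf_const (of_nat n / (1 - t_fract ^ n)) *
      (\<Sum>\<mu>\<in>partitions_of n. sf_const (?v \<mu>) * sf_map to_fract (cyclic_prod n \<mu>))"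
  proof (rule symfun_eqI)
    fix m
    have "(1 - [:0, 1:] ^ n) * sf_coeff (psum n) m =
        of_nat n * (\<Sum>\<mu>\<in>partitions_of n. ?w \<mu> * sf_coeff (cyclic_prod n \<mu>) m)"
      using arg_cong[OF psum_eq_sum_cyclic_prod[OF assms], of "\<lambda>f. sf_coeff f m"]
      by (simp only: sf_coeff_const_mult sf_coeff_sum)
    from arg_cong[OF this, of to_fract]
    have "(1 - t_fract ^ n) * to_fract (sf_coeff (psum n) m) =
        of_nat n * (\<Sum>\<mu>\<in>partitions_of n. to_fract (?w \<mu>) * to_fract (sf_coeff (cyclic_prod n \<mu>) m))"
      by (simp only: to_fract_mult to_fract_diff to_fract_1 to_fract_power to_fract_sum to_fract_of_nat t_fract_def)
    also have "\<dots> = of_nat n * sf_coeff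
        (\<Sum>\<mu>\<in>partitions_of n. sf_const (?v \<mu>) * sf_map to_fract (cyclic_prod n \<mu>)) m"
      by (simp only: sf_coeff_sum sf_coeff_const_mult sf_coeff_map[of to_fract, OF to_fract_0] w cong: sum.cong)
    also have "to_fract (sf_coeff (psum n) m) = sf_coeff (psum n) m"
      using assms by (simp add: sf_coeff_psum)
    finally show "sf_coeff (psum n) m = sf_coeff (sf_const (of_nat n / (1 - t_fract ^ n)) *
        (\<Sum>\<mu>\<in>partitions_of n. sf_const (?v \<mu>) * sf_map to_fract (cyclic_prod n \<mu>))) m"
      using nz by (simp only: sf_coeff_const_mult) (simp add: field_simps)
  qed
qed

end
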